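(* Let $K$ be an algebraically closed field, let $n\geq 3$ be an integer, let $H$ be a subgroup of $\mathrm{GL}_n(K)$ with $\mathrm{E}_n(K)\leq H\leq \mathrm{GL}_n(K)$, and let $T$ be the $H$-class of $t_{12}(1)$. Let $C$ be a noncentral $H$-class. Then $m(C)=1$ if $C=T$, and $m(C)=2$ if $C\neq T$.
   Context: $t_{ij}(a)=e+ae^{ij}$ ($i\neq j$, $a\in K$) is an elementary transvection, where $e$ is the identity matrix and $e^{ij}$ the matrix unit; $\mathrm{E}_n(K)$ is the subgroup of $\mathrm{GL}_n(K)$ generated by all elementary transvections. For $g\in \mathrm{GL}_n(K)$, the $H$-class of $g$ is $g^H=\{h^{-1}gh\mid h\in H\}$ ($g$ need not lie in $H$); it is noncentral if $g$ is not in the center of $\mathrm{GL}_n(K)$. If $C=g^H$, then $C^{1}:=C$ and $C^{-1}:=(g^{-1})^H$. Products of classes are elementwise products of sets. For a noncentral $H$-class $C$, $m(C)$ is the minimal positive integer $m$ such that there exist $i_1,\dots,i_m\in\{\pm1\}$ with $T\subseteq C^{i_1}\cdots C^{i_m}$. *)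

theory Defs
  imports
    "HOL-Algebra.Coset"
    "HOL-Algebra.Generated_Groups"
    "HOL-Computational_Algebra.Polynomial"
    "Jordan_Normal_Form.Matrix"
begin

definition GL :: "nat \<Rightarrow> 'a::field mat monoid" where
  "GL n = units_of (ring_mat TYPE('a) n ())"

definition matrix_unit :: "nat \<Rightarrow> nat \<Rightarrow> nat \<Rightarrow> 'a::field mat" where
  "matrix_unit n i j = mat n n (\<lambda>(k, l). if k = i \<and> l = j then 1 else 0)"

(* Rows and columns are numbered from 0, as everywhere in Jordan_Normal_Form.Matrix. *)
definition transvection :: "nat \<Rightarrow> nat \<Rightarrow> nat \<Rightarrow> 'a::field \<Rightarrow> 'a mat" where
  "transvection n i j a = 1\<^sub>m n + a \<cdot>\<^sub>m matrix_unit n i j"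

definition elementary_group :: "nat \<Rightarrow> 'a::field mat set" where
  "elementary_group n =
    generate (GL n) {transvection n i j a | i j a. i < n \<and> j < n \<and> i \<noteq> j}"

definition group_center :: "('a, 'b) monoid_scheme \<Rightarrow> 'a set" where
  "group_center G = {z \<in> carrier G. \<forall>x \<in> carrier G. z \<otimes>\<^bsub>G\<^esub> x = x \<otimes>\<^bsub>G\<^esub> z}"

definition conj_class :: "('a, 'b) monoid_scheme \<Rightarrow> 'a set \<Rightarrow> 'a \<Rightarrow> 'a set" where
  "conj_class G H g = {inv\<^bsub>G\<^esub> h \<otimes>\<^bsub>G\<^esub> g \<otimes>\<^bsub>G\<^esub> h | h. h \<in> H}"

definition noncentral_class :: "('a, 'b) monoid_scheme \<Rightarrow> 'a set \<Rightarrow> 'a set \<Rightarrow> bool" where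
  "noncentral_class G H C \<longleftrightarrow>
    (\<exists>g \<in> carrier G. g \<notin> group_center G \<and> C = conj_class G H g)"

(* The class of the inverse of a representative; see class_inverse_conj_class below for
   the independence of the representative. *)
definition class_inverse :: "('a, 'b) monoid_scheme \<Rightarrow> 'a set \<Rightarrow> 'a set \<Rightarrow> 'a set" where
  "class_inverse G H C =
    (THE D. \<exists>g \<in> carrier G. C = conj_class G H g \<and> D = conj_class G H (inv\<^bsub>G\<^esub> g))"

(* Only used for exponents 1 and -1. *)
definition class_power :: "('a, 'b) monoid_scheme \<Rightarrow> 'a set \<Rightarrow> 'a set \<Rightarrow> int \<Rightarrow> 'a set" where
  "class_power G H C i = (if i = 1 then C else class_inverse G H C)"

definition set_product :: "('a, 'b) monoid_scheme \<Rightarrow> 'a set list \<Rightarrow> 'a set" where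
  "set_product G Cs = foldr (set_mult G) Cs {\<one>\<^bsub>G\<^esub>}"

definition transvection_class :: "nat \<Rightarrow> 'a::field mat set \<Rightarrow> 'a mat set" where
  "transvection_class n H = conj_class (GL n) H (transvection n 0 1 1)"

(* On nat, Inf of a nonempty set is its least element and Inf {} = 0, so a positive value
   is always attained. *)
definition class_length :: "nat \<Rightarrow> 'a::field mat set \<Rightarrow> 'a mat set \<Rightarrow> nat" where
  "class_length n H C = Inf {m. m > 0 \<and>
    (\<exists>is :: int list. length is = m \<and> set is \<subseteq> {1, -1} \<and>
      transvection_class n H \<subseteq> set_product (GL n) (map (class_power (GL n) H C) is))}"

lemma group_GL: "group (GL n)"
proof -
  interpret ring "ring_mat TYPE('a::field) n ()" by (rule ring_mat)
  show ?thesis unfolding GL_def by (rule units_group)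
qed

lemma inv_conj_class:
  assumes "group G" "subgroup H G" "g \<in> carrier G"
  shows "(\<lambda>x. inv\<^bsub>G\<^esub> x) ` conj_class G H g = conj_class G H (inv\<^bsub>G\<^esub> g)"
proof -
  interpret group G by fact
  have "inv\<^bsub>G\<^esub> (inv\<^bsub>G\<^esub> h \<otimes>\<^bsub>G\<^esub> g \<otimes>\<^bsub>G\<^esub> h) = inv\<^bsub>G\<^esub> h \<otimes>\<^bsub>G\<^esub> inv\<^bsub>G\<^esub> g \<otimes>\<^bsub>G\<^esub> h"
    if "h \<in> H" for h
    using subgroup.mem_carrier[OF assms(2) that] assms(3) by (simp add: inv_mult_group m_assoc)
  then show ?thesis unfolding conj_class_def by (fastforce simp: image_iff)
qed

lemma class_inverse_conj_class:
  assumes "group G" "subgroup H G" "g \<in> carrier G"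
  shows "class_inverse G H (conj_class G H g) = conj_class G H (inv\<^bsub>G\<^esub> g)"
  unfolding class_inverse_def
  by (rule the_equality) (use assms in \<open>auto simp: inv_conj_class[symmetric]\<close>)

end

theory Submission
  imports Defs "Jordan_Normal_Form.Char_Poly"
begin

text \<open>
  Let \<open>g\<close> be a noncentral representative of \<open>C\<close>. As \<open>K\<close> is algebraically closed and \<open>n \<ge> 3\<close>,
  there are an eigenvector \<open>a\<close> of \<open>g\<close> with eigenvalue \<open>e\<close> and a covector \<open>b\<close> with \<open>b a = 0\<close> that
  is not a left eigenvector for \<open>e\<close>. With \<open>h = 1 + a b\<close> the commutator
  \<open>g\<inverse> h\<inverse> g h\<close> equals \<open>1 + a c\<close>, where \<open>c = b - e\<inverse> b g\<close> is nonzero and \<open>c a = 0\<close>.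
  All matrices of this form are conjugate under elementary transvections to \<open>t\<^sub>1\<^sub>2(1)\<close>;
  hence \<open>h \<in> H\<close> and \<open>T \<subseteq> C\<inverse> C\<close>. The same conjugacy shows that \<open>T\<close> is closed under inverses, so
  \<open>m(C) = 1\<close> only if \<open>C = T\<close>.
\<close>

section \<open>The general linear group in terms of matrix operations\<close>

lemma GL_mult: "(\<otimes>\<^bsub>GL n\<^esub>) = (*)"
  by (simp add: GL_def units_of_mult ring_mat_simps)

lemma GL_one: "\<one>\<^bsub>GL n\<^esub> = 1\<^sub>m n"
  by (simp add: GL_def units_of_one ring_mat_simps)

lemma GL_carrierD: "x \<in> carrier (GL n) \<Longrightarrow> x \<in> carrier_mat n n"
  by (simp add: GL_def units_of_carrier Units_def ring_mat_simps)

lemma GL_carrierI: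
  "\<lbrakk>x \<in> carrier_mat n n; y \<in> carrier_mat n n; x * y = 1\<^sub>m n; y * x = 1\<^sub>m n\<rbrakk>
    \<Longrightarrow> x \<in> carrier (GL n)"
  by (auto simp: GL_def units_of_carrier Units_def ring_mat_simps)

section \<open>Classes under conjugation by a subgroup\<close>

lemma conj_class_self:
  fixes G (structure)
  assumes "group G" "subgroup H G" "g \<in> carrier G"
  shows "g \<in> conj_class G H g"
proof -
  interpret group G by fact
  have "g = inv \<one> \<otimes> g \<otimes> \<one>" using assms by simp
  then show ?thesis
    unfolding conj_class_def using subgroup.one_closed[OF assms(2)] by blast
qed

lemma conj_class_closed:
  fixes G (structure)
  assumes "group G" "subgroup H G" "g \<in> carrier G" "x \<in> conj_class G H g" "h \<in> H"
  shows "inv\<^bsub>G\<^esub> h \<otimes>\<^bsub>G\<^esub> x \<otimes>\<^bsub>G\<^esub> h \<in> conj_class G H g"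
proof -
  interpret group G by fact
  interpret H: subgroup H G by fact
  from assms(4) obtain k where k: "k \<in> H" "x = inv k \<otimes> g \<otimes> k"
    unfolding conj_class_def by blast
  have "inv h \<otimes> x \<otimes> h = inv (k \<otimes> h) \<otimes> g \<otimes> (k \<otimes> h)"
    using k assms by (simp add: inv_mult_group m_assoc)
  then show ?thesis
    unfolding conj_class_def using H.m_closed[OF k(1) assms(5)] by blast
qed

text \<open>Conjugation by \<open>inv k\<close> leads from \<open>x\<close> back to
  \<open>g\<close>, so the relation is symmetric, and \<open>conj_class_closed\<close> gives both
  inclusions. Thus a single common element identifies two \<open>H\<close>-classes.\<close>

lemma conj_class_eq:
  fixes G (structure)
  assumes "group G" "subgroup H G" "g \<in> carrier G" "x \<in> conj_class G H g"
  shows "conj_class G H x = conj_class G H g"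
proof -
  interpret group G by fact
  interpret H: subgroup H G by fact
  from assms(4) obtain k where k: "k \<in> H" "x = inv k \<otimes> g \<otimes> k"
    unfolding conj_class_def by blast
  have kc: "k \<in> carrier G" using k by simp
  have xc: "x \<in> carrier G" using k assms by simp
  have cancel: "k \<otimes> (inv k \<otimes> z) = z" if "z \<in> carrier G" for z
    using that kc by (simp flip: m_assoc)
  have "g = inv (inv k) \<otimes> x \<otimes> inv k"
    unfolding k(2) using kc assms(3) by (simp add: m_assoc cancel)
  then have g: "g \<in> conj_class G H x"
    unfolding conj_class_def using H.m_inv_closed[OF k(1)] by blast
  show ?thesis
  proof
    show "conj_class G H x \<subseteq> conj_class G H g"
      using conj_class_closed[OF assms(1-4)] unfolding conj_class_def[of G H x] by blast
    show "conj_class G H g \<subseteq> conj_class G H x"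
      using conj_class_closed[OF assms(1,2) xc g] unfolding conj_class_def[of G H g] by blast
  qed
qed

lemma conj_class_subset:
  assumes "subgroup H G" "g \<in> H"
  shows "conj_class G H g \<subseteq> H"
  using assms by (auto simp: conj_class_def subgroup.m_closed subgroup.m_inv_closed)

text \<open>Conjugation by \<open>k\<close> is multiplicative, so it splits the commutator into a
  conjugate of \<open>inv g\<close> times a conjugate of \<open>g\<close>. This turns one commutator
  into an inclusion of a whole class.\<close>

lemma conj_class_commutator_subset:
  fixes G (structure)
  assumes "group G" "subgroup H G" "g \<in> carrier G" "h \<in> H"
  shows "conj_class G H (inv\<^bsub>G\<^esub> g \<otimes>\<^bsub>G\<^esub> (inv\<^bsub>G\<^esub> h \<otimes>\<^bsub>G\<^esub> g \<otimes>\<^bsub>G\<^esub> h)) \<subseteq>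
    conj_class G H (inv\<^bsub>G\<^esub> g) <#>\<^bsub>G\<^esub> conj_class G H g"
proof
  interpret group G by fact
  interpret H: subgroup H G by fact
  fix t assume "t \<in> conj_class G H (inv g \<otimes> (inv h \<otimes> g \<otimes> h))"
  then obtain k where k: "k \<in> H" "t = inv k \<otimes> (inv g \<otimes> (inv h \<otimes> g \<otimes> h)) \<otimes> k"
    unfolding conj_class_def by blast
  have kc: "k \<in> carrier G" using k by simp
  have cancel: "k \<otimes> (inv k \<otimes> z) = z" if "z \<in> carrier G" for z
    using that kc by (simp flip: m_assoc)
  have t: "t = (inv k \<otimes> inv g \<otimes> k) \<otimes> (inv k \<otimes> (inv h \<otimes> g \<otimes> h) \<otimes> k)"
    unfolding k(2) using assms(3,4) kc by (simp add: m_assoc cancel)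
  have "inv k \<otimes> inv g \<otimes> k \<in> conj_class G H (inv g)"
    unfolding conj_class_def using k(1) by blast
  moreover have "inv k \<otimes> (inv h \<otimes> g \<otimes> h) \<otimes> k \<in> conj_class G H g"
    using conj_class_closed[OF assms(1-3) _ k(1)] conj_class_closed[OF assms(1-3) _ assms(4)]
      conj_class_self[OF assms(1-3)] by blast
  ultimately show "t \<in> conj_class G H (inv g) <#> conj_class G H g"
    unfolding t set_mult_def by blast
qed

lemma set_product_single:
  fixes G (structure)
  assumes "group G" "A \<subseteq> carrier G"
  shows "set_product G [A] = A"
proof -
  interpret group G by fact
  show ?thesis using assms(2) by (auto simp: set_product_def set_mult_def subset_iff)
qed

lemma conj_class_subset_carrier:
  fixes G (structure)
  assumes "group G" "subgroup H G" "g \<in> carrier G"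
  shows "conj_class G H g \<subseteq> carrier G"
proof -
  interpret group G by fact
  interpret H: subgroup H G by fact
  show ?thesis using assms(3) by (auto simp: conj_class_def)
qed

section \<open>Rank-one updates of the identity matrix\<close>

text \<open>This is the matrix 1 + a c for a column \<open>a\<close> and a row \<open>c\<close>.
  Both are functions rather than vectors, so that single entries can be changed by function update;
  only their values below \<open>n\<close> enter the matrix.\<close>

definition rank1_update :: "nat \<Rightarrow> (nat \<Rightarrow> 'a::field) \<Rightarrow> (nat \<Rightarrow> 'a) \<Rightarrow> 'a mat" where
  "rank1_update n a c = mat n n (\<lambda>(i, j). (if i = j then 1 else 0) + a i * c j)"

lemma rank1_update_carrier [simp]: "rank1_update n a c \<in> carrier_mat n n"
  and dim_rank1_update [simp]: "dim_row (rank1_update n a c) = n" "dim_col (rank1_update n a c) = n"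
  by (auto simp: rank1_update_def)

lemma rank1_update_cong:
  "\<lbrakk>\<And>i. i < n \<Longrightarrow> a i = a' i; \<And>i. i < n \<Longrightarrow> c i = c' i\<rbrakk>
    \<Longrightarrow> rank1_update n a c = rank1_update n a' c'"
  by (rule eq_matI) (auto simp: rank1_update_def)

lemma transvection_eq_rank1_update:
  "transvection n i j s =
    rank1_update n (\<lambda>k. if k = i then s else 0) (\<lambda>k. if k = j then 1 else 0)"
  by (rule eq_matI) (auto simp: transvection_def matrix_unit_def rank1_update_def)

lemma rank1_update_mult_index:
  assumes "M \<in> carrier_mat n n" "i < n" "j < n"
  shows "(rank1_update n a c * M) $$ (i, j) = M $$ (i, j) + a i * (\<Sum>k = 0..<n. c k * M $$ (k, j))"
proof -
  have "(rank1_update n a c * M) $$ (i, j) =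
    (\<Sum>k = 0..<n. ((if i = k then 1 else 0) + a i * c k) * M $$ (k, j))"
    using assms by (simp add: rank1_update_def scalar_prod_def)
  also have "\<dots> = (\<Sum>k = 0..<n. (if i = k then M $$ (k, j) else 0) + a i * (c k * M $$ (k, j)))"
    by (rule sum.cong) (auto simp: algebra_simps)
  also have "\<dots> = M $$ (i, j) + a i * (\<Sum>k = 0..<n. c k * M $$ (k, j))"
    using assms(2) by (simp add: sum.distrib sum_distrib_left)
  finally show ?thesis .
qed

lemma mult_rank1_update_index:
  assumes "M \<in> carrier_mat n n" "i < n" "j < n"
  shows "(M * rank1_update n a c) $$ (i, j) = M $$ (i, j) + (\<Sum>k = 0..<n. M $$ (i, k) * a k) * c j"
proof -
  have "(M * rank1_update n a c) $$ (i, j) =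
    (\<Sum>k = 0..<n. M $$ (i, k) * ((if k = j then 1 else 0) + a k * c j))"
    using assms by (simp add: rank1_update_def scalar_prod_def)
  also have "\<dots> = (\<Sum>k = 0..<n. (if k = j then M $$ (i, k) else 0) + (M $$ (i, k) * a k) * c j)"
    by (rule sum.cong) (auto simp: algebra_simps)
  also have "\<dots> = M $$ (i, j) + (\<Sum>k = 0..<n. M $$ (i, k) * a k) * c j"
    using assms(3) by (simp add: sum.distrib sum_distrib_right)
  finally show ?thesis .
qed

text \<open>Expanding (1 + a b)(1 + a c) leaves a (b a) c as the only quadratic term, and b a = 0.
  For a fixed column, multiplication thus becomes addition of rows.\<close>

lemma rank1_update_mult_rank1_update:
  assumes "(\<Sum>k = 0..<n. b k * a k) = 0"
  shows "rank1_update n a b * rank1_update n a c = rank1_update n a (\<lambda>k. b k + c k)"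
proof (rule eq_matI)
  fix i j assume "i < dim_row (rank1_update n a (\<lambda>k. b k + c k))"
    and "j < dim_col (rank1_update n a (\<lambda>k. b k + c k))"
  then have ij: "i < n" "j < n" by simp_all
  have "(\<Sum>k = 0..<n. b k * rank1_update n a c $$ (k, j)) =
    (\<Sum>k = 0..<n. (if k = j then b k else 0) + (b k * a k) * c j)"
    using ij by (intro sum.cong) (auto simp: rank1_update_def algebra_simps)
  also have "\<dots> = b j"
    using ij assms by (simp add: sum.distrib flip: sum_distrib_right)
  finally show "(rank1_update n a b * rank1_update n a c) $$ (i, j) =
      rank1_update n a (\<lambda>k. b k + c k) $$ (i, j)"
    using ij rank1_update_mult_index[of "rank1_update n a c" n i j a b]
    by (simp add: rank1_update_def algebra_simps)
qed simp_all

lemma rank1_update_0: "rank1_update n a (\<lambda>k. 0) = 1\<^sub>m n"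
  by (rule eq_matI) (auto simp: rank1_update_def)

lemma rank1_update_inverse:
  assumes "(\<Sum>k = 0..<n. b k * a k) = 0"
  shows "rank1_update n a b * rank1_update n a (\<lambda>k. - b k) = 1\<^sub>m n"
    and "rank1_update n a (\<lambda>k. - b k) * rank1_update n a b = 1\<^sub>m n"
  using assms
  by (simp_all add: rank1_update_mult_rank1_update sum_negf rank1_update_0)

lemma rank1_update_in_GL:
  assumes "(\<Sum>k = 0..<n. b k * a k) = 0"
  shows "rank1_update n a b \<in> carrier (GL n)"
  by (rule GL_carrierI[OF _ _ rank1_update_inverse[OF assms]]) simp_all

text \<open>For the transvection t, conjugation gives t (1 + a c) t^-1 = 1 + (t a)(c t^-1). The two
  function updates are t a and c t^-1; stating the identity as t R = R' t avoids inverse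
  matrices.\<close>

lemma transvection_mult_rank1_update:
  fixes a c :: "nat \<Rightarrow> 'a::field"
  assumes "i < n" "j < n" "i \<noteq> j"
  shows "transvection n i j s * rank1_update n a c =
    rank1_update n (a(i := a i + s * a j)) (c(j := c j - s * c i)) * transvection n i j s"
    (is "?t * ?R = ?R' * ?t")
proof (rule eq_matI)
  fix k l assume "k < dim_row (?R' * ?t)" "l < dim_col (?R' * ?t)"
  then have kl: "k < n" "l < n"
    by (simp_all add: transvection_eq_rank1_update)
  have "(\<Sum>m = 0..<n. (if m = j then 1 else 0) * ?R $$ (m, l)) = ?R $$ (j, l)"
    using assms(2) by (subst sum.remove[of _ j]) auto
  then have l: "(?t * ?R) $$ (k, l) = ?R $$ (k, l) + (if k = i then s else 0) * ?R $$ (j, l)"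
    unfolding transvection_eq_rank1_update
    by (subst rank1_update_mult_index[OF rank1_update_carrier kl]) simp
  have "(\<Sum>m = 0..<n. ?R' $$ (k, m) * (if m = i then s else 0)) = ?R' $$ (k, i) * s"
    using assms(1) by (subst sum.remove[of _ i]) auto
  then have r: "(?R' * ?t) $$ (k, l) = ?R' $$ (k, l) + ?R' $$ (k, i) * s * (if l = j then 1 else 0)"
    unfolding transvection_eq_rank1_update
    by (subst mult_rank1_update_index[OF rank1_update_carrier kl]) simp
  show "(?t * ?R) $$ (k, l) = (?R' * ?t) $$ (k, l)"
    unfolding l r using kl assms by (auto simp: rank1_update_def algebra_simps)
qed (simp_all add: transvection_eq_rank1_update)

section \<open>Conjugating rank-one updates to the first transvection\<close>

locale elementary_overgroup =
  fixes n :: nat and H :: "'a::field mat set"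
  assumes n3: "n \<ge> 3" and subgroup_H: "subgroup H (GL n)"
    and elementary_subset: "elementary_group n \<subseteq> H"
begin

abbreviation T :: "'a mat set" where "T \<equiv> transvection_class n H"

lemma transvection_in_H:
  assumes "i < n" "j < n" "i \<noteq> j"
  shows "transvection n i j s \<in> H"
proof -
  have "transvection n i j s \<in> elementary_group n"
    unfolding elementary_group_def
    by (rule generate.incl, rule CollectI, intro exI conjI, rule refl) (use assms in simp_all)
  then show ?thesis using elementary_subset by (rule subsetD[rotated])
qed

lemma transvection_in_GL:
  "\<lbrakk>i < n; j < n; i \<noteq> j\<rbrakk> \<Longrightarrow> transvection n i j (s :: 'a) \<in> carrier (GL n)"
  by (rule subgroup.mem_carrier[OF subgroup_H]) (rule transvection_in_H)

lemma transvection_01_in_GL: "transvection n 0 1 (1 :: 'a) \<in> carrier (GL n)"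
  by (rule transvection_in_GL) (use n3 in simp_all)

lemma T_subset_H: "T \<subseteq> H"
  unfolding transvection_class_def
  by (rule conj_class_subset[OF subgroup_H], rule transvection_in_H) (use n3 in simp_all)

text \<open>The basic reduction step, used backwards: a row operation on \<open>a\<close>,
  accompanied by the contragredient operation on \<open>c\<close>, may be applied before membership
  in \<open>T\<close> is proved.\<close>

lemma elementary_move:
  assumes "i < n" "j < n" "i \<noteq> j"
    and "rank1_update n (a(i := a i + s * a j)) (c(j := c j - s * c i)) \<in> T"
  shows "rank1_update n a c \<in> T"
proof -
  interpret GL: group "GL n" by (rule group_GL)
  let ?t = "transvection n i j s" and ?R = "rank1_update n a c"
    and ?R' = "rank1_update n (a(i := a i + s * a j)) (c(j := c j - s * c i))"
  have t: "?t \<in> H" "?t \<in> carrier (GL n)"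
    by (rule transvection_in_H[OF assms(1-3)], rule transvection_in_GL[OF assms(1-3)])
  have ti: "inv\<^bsub>GL n\<^esub> ?t \<in> carrier_mat n n" "?t \<in> carrier_mat n n" "inv\<^bsub>GL n\<^esub> ?t * ?t = 1\<^sub>m n"
    using GL_carrierD[OF GL.inv_closed[OF t(2)]] GL_carrierD[OF t(2)] GL.l_inv[OF t(2)]
    by (simp_all add: GL_mult GL_one)
  have "?R = inv\<^bsub>GL n\<^esub> ?t * ?t * ?R"
    by (simp add: ti)
  also have "\<dots> = inv\<^bsub>GL n\<^esub> ?t * (?t * ?R)"
    by (rule assoc_mult_mat) (use ti in auto)
  also have "\<dots> = inv\<^bsub>GL n\<^esub> ?t * (?R' * ?t)"
    using transvection_mult_rank1_update[OF assms(1-3)] by metis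
  also have "\<dots> = inv\<^bsub>GL n\<^esub> ?t * ?R' * ?t"
    by (rule assoc_mult_mat[symmetric]) (use ti in auto)
  also have "\<dots> \<in> T"
    using conj_class_closed[OF group_GL subgroup_H transvection_01_in_GL, of ?R' ?t]
      assms(4) t(1)
    by (simp add: GL_mult transvection_class_def)
  finally show ?thesis .
qed

text \<open>The entry 1 at index 1 of \<open>c\<close> clears the entries from index 2 on, one by
  one; the induction counts those still nonzero. What remains is
  \<open>transvection n 0 1 1\<close>.\<close>

lemma rank1_update_in_T_if_unit_vector_and_entry_one:
  assumes "a 0 = 1" "\<And>k. \<lbrakk>k < n; k \<noteq> 0\<rbrakk> \<Longrightarrow> a k = 0" "c 0 = 0" "c 1 = 1"
  shows "rank1_update n a c \<in> T"
  using assms(3,4)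
proof (induction "card {k. 2 \<le> k \<and> k < n \<and> c k \<noteq> 0}" arbitrary: c rule: less_induct)
  case less
  show ?case
  proof (cases "{k. 2 \<le> k \<and> k < n \<and> c k \<noteq> 0} = {}")
    case True
    have "c k = (if k = 1 then 1 else 0)" if "k < n" for k
      using True less.prems that by (cases "k = 0"; cases "k = 1") auto
    then have "rank1_update n a c = transvection n 0 1 1"
      unfolding transvection_eq_rank1_update
      by (intro rank1_update_cong) (use assms(1,2) in auto)
    then show ?thesis
      using conj_class_self[OF group_GL subgroup_H transvection_01_in_GL]
      by (simp add: transvection_class_def)
  next
    case False
    then obtain j where j: "2 \<le> j" "j < n" "c j \<noteq> 0" by blast
    \<comment> \<open>As \<open>c 1\<close> is 1, this move with parameter \<open>c j\<close> clears
      entry \<open>j\<close>. The companion change of \<open>a\<close> adds a multiple of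
      \<open>a j\<close>, which is 0.\<close>
    let ?c = "c(j := c j - c j * c 1)"
    have c: "?c 0 = 0" "?c 1 = 1" "?c j = 0" using j less.prems by simp_all
    have "{k. 2 \<le> k \<and> k < n \<and> ?c k \<noteq> 0} \<subset> {k. 2 \<le> k \<and> k < n \<and> c k \<noteq> 0}"
      using j c(3) by (intro psubsetI) (auto split: if_splits)
    then have "card {k. 2 \<le> k \<and> k < n \<and> ?c k \<noteq> 0} < card {k. 2 \<le> k \<and> k < n \<and> c k \<noteq> 0}"
      by (rule psubset_card_mono[rotated]) simp
    from less.hyps[OF this c(1,2)] have "rank1_update n a ?c \<in> T" .
    moreover have "a j = 0" using assms(2) j by simp
    ultimately have "rank1_update n (a(1 := a 1 + c j * a j)) ?c \<in> T"
      by (simp only: mult_zero_right add_0_right fun_upd_triv)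
    then show ?thesis
      by (rule elementary_move[of 1 j, rotated 3]) (use j n3 in auto)
  qed
qed

text \<open>A nonzero entry of \<open>c\<close> at some index other than 1 can be used to turn
  \<open>c 1\<close> into 1. Index 0 is excluded since \<open>c 0\<close> is 0, so an index from 2
  on is required.\<close>

lemma rank1_update_in_T_if_unit_vector:
  assumes "a 0 = 1" "\<And>k. \<lbrakk>k < n; k \<noteq> 0\<rbrakk> \<Longrightarrow> a k = 0" "c 0 = 0" "k < n" "c k \<noteq> 0"
  shows "rank1_update n a c \<in> T"
proof -
  have fix_a: "a(i := a i + s * a j) = a" if "j < n" "j \<noteq> 0" for i j s
    by (simp only: assms(2)[OF that] mult_zero_right add_0_right fun_upd_triv)
  \<comment> \<open>The parameter \<open>(c 1 - 1) / c j\<close> is chosen so that the new entry at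
    index 1 equals 1.\<close>
  have *: "rank1_update n a c \<in> T" if c: "c 0 = 0" and j: "2 \<le> j" "j < n" "c j \<noteq> 0" for c j
  proof (rule elementary_move[of j 1 a "(c 1 - 1) / c j" c])
    let ?c = "c(1 := c 1 - (c 1 - 1) / c j * c j)"
    have "?c 0 = 0" "?c 1 = 1" using c j(3) by simp_all
    then have "rank1_update n a ?c \<in> T"
      using rank1_update_in_T_if_unit_vector_and_entry_one[of a ?c] assms(1,2) by blast
    moreover have "1 < n" using n3 by simp
    ultimately show "rank1_update n (a(j := a j + (c 1 - 1) / c j * a 1)) ?c \<in> T"
      by (simp only: fix_a one_neq_zero not_False_eq_True)
  qed (use j n3 in auto)
  show ?thesis
  proof (cases "k = 1")
    case True
    \<comment> \<open>Only \<open>c 1\<close> is known to be nonzero, and it cannot rescale itself.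
      It is first used to set entry 2 to 1, after which \<open>*\<close> applies; index 2 exists
      because \<open>n\<close> is at least 3.\<close>
    show ?thesis
    proof (rule elementary_move[of 1 2 a "(c 2 - 1) / c 1" c])
      let ?c = "c(2 := c 2 - (c 2 - 1) / c 1 * c 1)"
      have "?c 0 = 0" "?c 2 \<noteq> 0" using True assms(3,5) by simp_all
      moreover have two: "2 < n" using n3 by simp
      ultimately have "rank1_update n a ?c \<in> T"
        using *[of ?c 2] by blast
      then show "rank1_update n (a(1 := a 1 + (c 2 - 1) / c 1 * a 2)) ?c \<in> T"
        by (simp only: fix_a[OF two] zero_neq_numeral[symmetric] not_False_eq_True)
    qed (use n3 in auto)
  next
    case False
    with assms(3,5) have "k \<ge> 2" by (cases "k = 0") auto
    then show ?thesis using * assms(3-5) by blast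
  qed
qed

text \<open>The pairing is invariant because (c t^-1)(t a) = c a; in coordinates, the changes at
  \<open>i\<close> and \<open>j\<close> cancel.\<close>

lemma dot_elementary_move:
  fixes a c :: "nat \<Rightarrow> 'a"
  assumes "i < n" "j < n" "i \<noteq> j"
  shows "(\<Sum>k = 0..<n. (c(j := c j - s * c i)) k * (a(i := a i + s * a j)) k) =
    (\<Sum>k = 0..<n. c k * a k)"
proof -
  have *: "(\<Sum>k = 0..<n. f k) = f i + (f j + (\<Sum>k \<in> {0..<n} - {i} - {j}. f k))" 
    for f :: "nat \<Rightarrow> 'a"
    using assms sum.remove[of "{0..<n}" i f] sum.remove[of "{0..<n} - {i}" j f] by simp
  have **: "(\<Sum>k \<in> {0..<n} - {i} - {j}. (c(j := c j - s * c i)) k * (a(i := a i + s * a j)) k) =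
    (\<Sum>k \<in> {0..<n} - {i} - {j}. c k * a k)"
    by (rule sum.cong) auto
  show ?thesis
    unfolding * ** using assms by (simp add: algebra_simps)
qed

text \<open>Either \<open>c i\<close> is 0 and the move changes nothing, or \<open>c i\<close> is
  itself a nonzero entry left untouched.\<close>

lemma nonzero_elementary_move:
  fixes c :: "nat \<Rightarrow> 'a"
  assumes "i < n" "i \<noteq> j" "\<exists>k<n. c k \<noteq> 0"
  shows "\<exists>k<n. (c(j := c j - s * c i)) k \<noteq> 0"
proof (cases "c i = 0")
  case True
  then show ?thesis using assms by auto
next
  case False
  then show ?thesis using assms by (intro exI[of _ i]) auto
qed

text \<open>The entry 1 at index 0 of \<open>a\<close> clears the other entries, with induction on
  the number of nonzero ones. Once \<open>a\<close> is a unit vector, c a = 0 says that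
  \<open>c 0\<close> is 0, as the previous reduction demands.\<close>

lemma rank1_update_in_T_if_first_entry_one:
  assumes "a 0 = 1" "(\<Sum>k = 0..<n. c k * a k) = 0" "\<exists>k<n. c k \<noteq> 0"
  shows "rank1_update n a c \<in> T"
  using assms
proof (induction "card {k. 1 \<le> k \<and> k < n \<and> a k \<noteq> 0}" arbitrary: a c rule: less_induct)
  case less
  show ?case
  proof (cases "{k. 1 \<le> k \<and> k < n \<and> a k \<noteq> 0} = {}")
    case True
    then have a: "a k = 0" if "k < n" "k \<noteq> 0" for k
      using that by (auto simp: Suc_le_eq)
    have "(\<Sum>k = 0..<n. c k * a k) = (\<Sum>k \<in> {0}. c k * a k)"
      using n3 a by (intro sum.mono_neutral_right) auto
    then have "c 0 = 0" using less.prems by simp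
    then show ?thesis using rank1_update_in_T_if_unit_vector a less.prems by blast
  next
    case False
    then obtain i where i: "1 \<le> i" "i < n" "a i \<noteq> 0" by blast
    let ?a = "a(i := a i + (- a i) * a 0)" and ?c = "c(0 := c 0 - (- a i) * c i)"
    have "rank1_update n ?a ?c \<in> T"
    proof (rule less.hyps)
      have "{k. 1 \<le> k \<and> k < n \<and> ?a k \<noteq> 0} \<subset> {k. 1 \<le> k \<and> k < n \<and> a k \<noteq> 0}"
        using i less.prems by (intro psubsetI) (auto split: if_splits)
      then show "card {k. 1 \<le> k \<and> k < n \<and> ?a k \<noteq> 0} < card {k. 1 \<le> k \<and> k < n \<and> a k \<noteq> 0}"
        by (rule psubset_card_mono[rotated]) simp
      show "(\<Sum>k = 0..<n. ?c k * ?a k) = 0"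
        by (subst dot_elementary_move) (use i less.prems in auto)
      show "\<exists>k<n. ?c k \<noteq> 0"
        by (rule nonzero_elementary_move) (use i less.prems in auto)
    qed (use i less.prems in auto)
    then show ?thesis
      by (rule elementary_move[of i 0, rotated 3]) (use i n3 in auto)
  qed
qed

text \<open>The conjugacy statement behind the whole proof: all nontrivial matrices 1 + a c with c a
  = 0 lie in \<open>T\<close>. It remains to bring the entry of \<open>a\<close> at index 0 to
  1.\<close>

lemma rank1_update_in_T:
  assumes "(\<Sum>k = 0..<n. c k * a k) = 0" "\<exists>k<n. c k \<noteq> 0" "\<exists>k<n. a k \<noteq> 0"
  shows "rank1_update n a c \<in> T"
proof -
  \<comment> \<open>A nonzero entry \<open>a j\<close> with \<open>j\<close> positive can be scaled
    and added to \<open>a 0\<close> to give exactly 1.\<close>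
  have *: "rank1_update n a c \<in> T"
    if d: "(\<Sum>k = 0..<n. c k * a k) = 0" "\<exists>k<n. c k \<noteq> 0" and j: "0 < j" "j < n" "a j \<noteq> 0" for a c j
  proof (rule elementary_move[of 0 j a "(1 - a 0) / a j" c])
    show "rank1_update n (a(0 := a 0 + (1 - a 0) / a j * a j))
        (c(j := c j - (1 - a 0) / a j * c 0)) \<in> T"
    proof (rule rank1_update_in_T_if_first_entry_one)
      show "(\<Sum>k = 0..<n. (c(j := c j - (1 - a 0) / a j * c 0)) k *
          (a(0 := a 0 + (1 - a 0) / a j * a j)) k) = 0"
        by (subst dot_elementary_move) (use j d in auto)
      show "\<exists>k<n. (c(j := c j - (1 - a 0) / a j * c 0)) k \<noteq> 0"
        by (rule nonzero_elementary_move) (use j d in auto)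
    qed (use j in auto)
  qed (use j in auto)
  obtain k where k: "k < n" "a k \<noteq> 0" using assms(3) by blast
  show ?thesis
  proof (cases "\<exists>j. 0 < j \<and> j < n \<and> a j \<noteq> 0")
    case True
    then show ?thesis using * assms by blast
  next
    case False
    then have "a 1 = 0" using n3 by (auto dest: spec[of _ 1])
    have "a 0 \<noteq> 0" using k False by (cases "k = 0") auto
    \<comment> \<open>Here \<open>a\<close> is supported at index 0 alone. Adding \<open>a 0\<close>
      to the vanishing entry at index 1 produces the nonzero entry required by
      \<open>*\<close>.\<close>
    show ?thesis
    proof (rule elementary_move[of 1 0 a 1 c])
      show "rank1_update n (a(1 := a 1 + 1 * a 0)) (c(0 := c 0 - 1 * c 1)) \<in> T"
      proof (rule *[of _ _ 1])
        show "(\<Sum>k = 0..<n. (c(0 := c 0 - 1 * c 1)) k * (a(1 := a 1 + 1 * a 0)) k) = 0"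
          by (subst dot_elementary_move) (use n3 assms in auto)
        show "\<exists>k<n. (c(0 := c 0 - 1 * c 1)) k \<noteq> 0"
          by (rule nonzero_elementary_move) (use n3 assms in auto)
      qed (use \<open>a 0 \<noteq> 0\<close> \<open>a 1 = 0\<close> n3 in auto)
    qed (use n3 in auto)
  qed
qed

text \<open>Negating the row inverts 1 + a b, and the result has the same shape. This settles the
  exponent -1 for products of length one.\<close>

lemma inv_transvection_01_in_T: "inv\<^bsub>GL n\<^esub> (transvection n 0 1 1) \<in> T"
proof -
  interpret GL: group "GL n" by (rule group_GL)
  let ?a = "\<lambda>k. if k = 0 then 1 else 0 :: 'a" and ?b = "\<lambda>k. if k = 1 then 1 else 0 :: 'a"
  have dot: "(\<Sum>k = 0..<n. ?b k * ?a k) = 0"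
    by (rule sum.neutral) auto
  have neg: "(\<Sum>k = 0..<n. - ?b k * ?a k) = 0"
    by (rule sum.neutral) auto
  have "inv\<^bsub>GL n\<^esub> (rank1_update n ?a ?b) = rank1_update n ?a (\<lambda>k. - ?b k)"
    by (rule GL.inv_equality)
      (simp_all only: GL_mult GL_one rank1_update_inverse[OF dot] rank1_update_in_GL dot neg)
  moreover have "rank1_update n ?a (\<lambda>k. - ?b k) \<in> T"
    by (rule rank1_update_in_T[OF neg]) (use n3 in \<open>auto intro: exI[of _ 0] exI[of _ 1]\<close>)
  ultimately show ?thesis
    by (simp add: transvection_eq_rank1_update)
qed

end

section \<open>Eigenvectors and covectors of nonscalar matrices\<close>

lemma exists_eigenvector:
  fixes g :: "'a::alg_closed_field mat"
  assumes "g \<in> carrier_mat n n" "n > 0"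
  shows "\<exists>e a. (\<exists>i<n. a i \<noteq> 0) \<and> (\<forall>i<n. (\<Sum>k = 0..<n. g $$ (i, k) * a k) = e * a i)"
proof -
  have "degree (char_poly g) > 0"
    using degree_monic_char_poly[OF assms(1)] assms(2) by simp
  then obtain e where "poly (char_poly g) e = 0"
    using alg_closed_imp_poly_has_root by blast
  then have "eigenvalue g e" using eigenvalue_root_char_poly[OF assms(1)] by simp
  then obtain v where v: "v \<in> carrier_vec n" "v \<noteq> 0\<^sub>v n" "g *\<^sub>v v = e \<cdot>\<^sub>v v"
    using assms(1) unfolding eigenvalue_def eigenvector_def by auto
  have "\<exists>i<n. v $ i \<noteq> 0"
    using v(1,2) by (metis carrier_vecD eq_vecI index_zero_vec(1,2))
  moreover have "(\<Sum>k = 0..<n. g $$ (i, k) * v $ k) = e * v $ i" if "i < n" for i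
    using arg_cong[OF v(3), of "\<lambda>w. w $ i"] that v(1) assms(1)
    by (simp add: scalar_prod_def)
  ultimately show ?thesis by blast
qed

lemma sum_two_points:
  fixes f :: "nat \<Rightarrow> 'a::field"
  assumes "i < n" "j < n" "i \<noteq> j"
  shows "(\<Sum>k = 0..<n. (if k = i then x else if k = j then y else 0) * f k) = x * f i + y * f j"
    and "(\<Sum>k = 0..<n. f k * (if k = i then x else if k = j then y else 0)) = x * f i + y * f j"
proof -
  have "(\<Sum>k = 0..<n. (if k = i then x else if k = j then y else 0) * f k) =
      (\<Sum>k = 0..<n. (if k = i then x * f k else 0) + (if k = j then y * f k else 0))"
    using assms(3) by (intro sum.cong) auto
  then show "(\<Sum>k = 0..<n. (if k = i then x else if k = j then y else 0) * f k) = x * f i + y * f j"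
    using assms(1,2) by (simp add: sum.distrib)
  then show "(\<Sum>k = 0..<n. f k * (if k = i then x else if k = j then y else 0)) = x * f i + y * f j"
    by (simp add: mult.commute)
qed

text \<open>The bound on \<open>n\<close> is essential: for a nontrivial Jordan block of size 2,
  every covector orthogonal to the eigenvector is a left eigenvector for the same
  eigenvalue.\<close>

lemma exists_eigenvector_with_covector:
  fixes g :: "'a::alg_closed_field mat"
  assumes g: "g \<in> carrier_mat n n" and n: "n \<ge> 3"
    and nonscalar: "\<And>e. g \<noteq> e \<cdot>\<^sub>m 1\<^sub>m n"
  shows "\<exists>e a b. (\<exists>i<n. a i \<noteq> 0) \<and> (\<forall>i<n. (\<Sum>k = 0..<n. g $$ (i, k) * a k) = e * a i) \<and>
    (\<Sum>k = 0..<n. b k * a k) = 0 \<and> (\<exists>j<n. (\<Sum>k = 0..<n. b k * g $$ (k, j)) \<noteq> e * b j)"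
proof -
  obtain e a where a: "\<exists>i<n. a i \<noteq> 0" "\<And>i. i < n \<Longrightarrow> (\<Sum>k = 0..<n. g $$ (i, k) * a k) = e * a i"
    using exists_eigenvector[OF g] n by (metis less_le_trans zero_less_numeral)
  show ?thesis
  proof (cases "\<exists>b. (\<Sum>k = 0..<n. b k * a k) = 0 \<and> (\<exists>j<n. (\<Sum>k = 0..<n. b k * g $$ (k, j)) \<noteq> e * b j)")
    case True
    then show ?thesis using a by blast
  next
    case False
    then have no_b: "(\<Sum>k = 0..<n. b k * g $$ (k, j)) = e * b j"
      if "(\<Sum>k = 0..<n. b k * a k) = 0" "j < n" for b j
      using that by blast
    obtain p where p: "p < n" "a p \<noteq> 0" using a by blast
    \<comment> \<open>Row \<open>p\<close> of g - e divided by \<open>a p\<close>, the only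
      candidate for g - e = a d.\<close>
    define d where "d j = (g $$ (p, j) - (if p = j then e else 0)) / a p" for j
    txt \<open>As every covector orthogonal to \<open>a\<close> annihilates \<open>g - e\<close>, the latter is \<open>a d\<close>.
      Its kernel has dimension \<open>n - 1 \<ge> 2\<close>, so \<open>a\<close> can be replaced by an eigenvector \<open>x\<close>
      that is not proportional to \<open>a\<close>, and then some \<open>b\<close> with \<open>b x = 0\<close> has \<open>b a \<noteq> 0\<close>.\<close>
    have gd: "g $$ (i, j) = (if i = j then e else 0) + a i * d j" if ij: "i < n" "j < n" for i j
    proof (cases "i = p")
      case True
      then show ?thesis using p by (simp add: d_def)
    next
      case False
      \<comment> \<open>This covector is orthogonal to \<open>a\<close>; that it annihilates g - e
        says that rows \<open>i\<close> and \<open>p\<close> of g - e are in the ratio of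
        \<open>a i\<close> to \<open>a p\<close>.\<close>
      let ?b = "\<lambda>k. if k = i then a p else if k = p then - a i else 0"
      have "(\<Sum>k = 0..<n. ?b k * a k) = 0"
        using sum_two_points(1)[OF ij(1) p(1) False, of "a p" "- a i" a] by simp
      from no_b[OF this ij(2)] have "a p * g $$ (i, j) - a i * g $$ (p, j) = e * ?b j"
        using sum_two_points(1)[OF ij(1) p(1) False, of "a p" "- a i" "\<lambda>k. g $$ (k, j)"] by simp
      then show ?thesis
        using p False by (auto simp: d_def field_simps split: if_splits)
    qed
    have "\<exists>q<n. d q \<noteq> 0"
    proof (rule ccontr)
      assume "\<not> (\<exists>q<n. d q \<noteq> 0)"
      then have "g = e \<cdot>\<^sub>m 1\<^sub>m n"
        using g gd by (intro eq_matI) auto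
      then show False using nonscalar by blast
    qed
    then obtain q where q: "q < n" "d q \<noteq> 0" by blast
    have gsum: "(\<Sum>k = 0..<n. g $$ (i, k) * x k) = e * x i + a i * (\<Sum>k = 0..<n. d k * x k)"
      if "i < n" for i x
    proof -
      have "(\<Sum>k = 0..<n. g $$ (i, k) * x k) =
        (\<Sum>k = 0..<n. (if i = k then e * x k else 0) + a i * (d k * x k))"
        using that by (intro sum.cong) (auto simp: gd algebra_simps)
      also have "\<dots> = e * x i + a i * (\<Sum>k = 0..<n. d k * x k)"
        using that by (simp add: sum.distrib sum_distrib_left)
      finally show ?thesis .
    qed
    have gsum': "(\<Sum>k = 0..<n. b k * g $$ (k, j)) = e * b j + (\<Sum>k = 0..<n. b k * a k) * d j"
      if "j < n" for j b
    proof -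
      have "(\<Sum>k = 0..<n. b k * g $$ (k, j)) =
        (\<Sum>k = 0..<n. (if k = j then e * b k else 0) + (b k * a k) * d j)"
        using that by (intro sum.cong) (auto simp: gd algebra_simps)
      also have "\<dots> = e * b j + (\<Sum>k = 0..<n. b k * a k) * d j"
        using that by (simp add: sum.distrib sum_distrib_right)
      finally show ?thesis .
    qed
    \<comment> \<open>A kernel vector \<open>x\<close> of \<open>d\<close> is an eigenvector for
      \<open>e\<close>. The condition on \<open>r\<close> and \<open>s\<close> is a nonzero 2 by 2
      minor, expressing that \<open>x\<close> and \<open>a\<close> are not proportional.\<close>
    have finish: ?thesis
      if x: "(\<Sum>k = 0..<n. d k * x k) = 0" and rs: "r < n" "s < n" "r \<noteq> s" "x r \<noteq> 0"
        "x r * a s \<noteq> x s * a r" for x r s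
    proof -
      \<comment> \<open>With this choice b x = 0 identically, while b a is the minor assumed
        nonzero. Then b (g - e) = (b a) d is nonzero at \<open>q\<close>.\<close>
      define b where "b k = (if k = s then x r else if k = r then - x s else 0)" for k
      have bx: "(\<Sum>k = 0..<n. b k * x k) = 0" and ba: "(\<Sum>k = 0..<n. b k * a k) \<noteq> 0"
        unfolding b_def sum_two_points(1)[OF rs(2,1) rs(3)[symmetric]] using rs(5) by simp_all
      have "(\<Sum>k = 0..<n. b k * g $$ (k, q)) \<noteq> e * b q"
        using gsum'[OF q(1)] ba q(2) by simp
      moreover have "(\<Sum>k = 0..<n. g $$ (i, k) * x k) = e * x i" if "i < n" for i
        using gsum[OF that, of x] x by simp
      ultimately show ?thesis using bx rs(1,4) q(1) by blast
    qed
    \<comment> \<open>Two distinct indices among 0, 1, 2, both different from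
      \<open>q\<close>.\<close>
    define i where "i = (if q = 0 then 1 else 0 :: nat)"
    define k where "k = (if q = 2 then 1 else 2 :: nat)"
    have ik: "i < n" "k < n" "i \<noteq> k" "i \<noteq> q" "k \<noteq> q"
      using n by (auto simp: i_def k_def)
    have ker: "(\<Sum>l = 0..<n. d l * (if l = m then d q else if l = q then - d m else 0)) = 0"
      if "m < n" "m \<noteq> q" for m
      using sum_two_points(2)[OF that(1) q(1) that(2), of d "d q" "- d m"] by simp
    show ?thesis
    \<comment> \<open>If \<open>a i\<close> is 0, the kernel vector supported at \<open>i\<close>
      and \<open>q\<close> has a nonzero entry at \<open>i\<close> and so is not proportional to
      \<open>a\<close>. Otherwise the one supported at \<open>k\<close> and \<open>q\<close> works,
      since it vanishes at \<open>i\<close> and \<open>a\<close> does not.\<close>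
    proof (cases "a i = 0")
      case True
      then have "p \<noteq> i" using p by auto
      then show ?thesis
        using True p q ik by (intro finish[OF ker[OF ik(1,4)], of i p]) auto
    next
      case False
      then show ?thesis
        using q ik by (intro finish[OF ker[OF ik(2,5)], of k i]) auto
    qed
  qed
qed

lemma nonscalar_if_noncentral:
  fixes g :: "'a::field mat"
  assumes "g \<in> carrier (GL n)" "g \<notin> group_center (GL n)"
  shows "g \<noteq> e \<cdot>\<^sub>m 1\<^sub>m n"
proof
  assume g: "g = e \<cdot>\<^sub>m 1\<^sub>m n"
  have "g * x = x * g" if "x \<in> carrier (GL n)" for x
    using GL_carrierD[OF that]
    by (simp add: g mult_smult_assoc_mat[of _ n n _ n] mult_smult_distrib[of _ n n _ n])
  then show False using assms by (auto simp: group_center_def GL_mult)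
qed

text \<open>Permits the division by \<open>e\<close> in the commutator computation.\<close>

lemma eigenvalue_nonzero_if_invertible:
  fixes g :: "'a::field mat"
  assumes "g \<in> carrier (GL n)" "i < n" "a i \<noteq> 0"
    and "\<And>i. i < n \<Longrightarrow> (\<Sum>k = 0..<n. g $$ (i, k) * a k) = e * a i"
  shows "e \<noteq> 0"
proof
  assume "e = 0"
  interpret GL: group "GL n" by (rule group_GL)
  let ?v = "vec n a" and ?g' = "inv\<^bsub>GL n\<^esub> g"
  have g: "g \<in> carrier_mat n n" "?g' \<in> carrier_mat n n"
    using assms(1) by (auto intro: GL_carrierD)
  have "g *\<^sub>v ?v = 0\<^sub>v n"
    using assms(4) g(1) \<open>e = 0\<close> by (intro eq_vecI) (auto simp: scalar_prod_def)
  then have "(?g' * g) *\<^sub>v ?v = ?g' *\<^sub>v 0\<^sub>v n"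
    using g by (subst assoc_mult_mat_vec[of _ n n _ n]) auto
  moreover have "?g' * g = 1\<^sub>m n"
    using GL.l_inv[OF assms(1)] by (simp add: GL_mult GL_one)
  moreover have "?g' *\<^sub>v 0\<^sub>v n = 0\<^sub>v n"
    using g by (intro eq_vecI) (auto simp: scalar_prod_def)
  ultimately have "?v = 0\<^sub>v n" by simp
  from arg_cong[OF this, of "\<lambda>w. w $ i"] show False
    using assms(2,3) by simp
qed

section \<open>The commutator with a rank-one update\<close>

lemma (in elementary_overgroup) exists_commutator_in_T:
  fixes g :: "'a mat"
  assumes g: "g \<in> carrier (GL n)" and ai: "i < n" "a i \<noteq> 0"
    and ga: "\<And>i. i < n \<Longrightarrow> (\<Sum>k = 0..<n. g $$ (i, k) * a k) = e * a i"
    and ba: "(\<Sum>k = 0..<n. b k * a k) = 0"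
    and j: "j < n" "(\<Sum>k = 0..<n. b k * g $$ (k, j)) \<noteq> e * b j"
  shows "\<exists>h\<in>H. inv\<^bsub>GL n\<^esub> g \<otimes>\<^bsub>GL n\<^esub> (inv\<^bsub>GL n\<^esub> h \<otimes>\<^bsub>GL n\<^esub> g \<otimes>\<^bsub>GL n\<^esub> h) \<in> T"
proof -
  interpret GL: group "GL n" by (rule group_GL)
  have gm: "g \<in> carrier_mat n n" using g by (rule GL_carrierD)
  have e: "e \<noteq> 0" using eigenvalue_nonzero_if_invertible[OF g ai ga] .
  \<comment> \<open>Here \<open>w\<close> is the row b g and \<open>c\<close> is b - e^-1 b g. Since
    w a = b (g a) = e (b a) = 0, also c a = 0.\<close>
  define w where "w l = (\<Sum>k = 0..<n. b k * g $$ (k, l))" for l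
  define c where "c l = b l - w l / e" for l
  have "(\<Sum>l = 0..<n. w l * a l) = (\<Sum>k = 0..<n. \<Sum>l = 0..<n. b k * g $$ (k, l) * a l)"
    unfolding w_def sum_distrib_right by (rule sum.swap)
  also have "\<dots> = (\<Sum>k = 0..<n. b k * (e * a k))"
    by (intro sum.cong refl) (simp add: ga[symmetric] sum_distrib_left mult.assoc)
  also have "\<dots> = e * (\<Sum>k = 0..<n. b k * a k)"
    by (simp add: sum_distrib_left mult.left_commute)
  finally have wa: "(\<Sum>l = 0..<n. w l * a l) = 0" by (simp add: ba)
  have "(\<Sum>l = 0..<n. c l * a l) = (\<Sum>l = 0..<n. b l * a l) - (\<Sum>l = 0..<n. w l * a l) / e"
    by (simp add: c_def sum_subtractf sum_divide_distrib left_diff_distrib)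
  then have ca: "(\<Sum>l = 0..<n. c l * a l) = 0" by (simp add: ba wa)
  have "w j \<noteq> e * b j" using j(2) by (simp add: w_def)
  then have cj: "c j \<noteq> 0" using e by (auto simp: c_def)
  have "\<exists>k<n. b k \<noteq> 0"
  proof (rule ccontr)
    assume "\<not> (\<exists>k<n. b k \<noteq> 0)"
    then show False using j by simp
  qed
  \<comment> \<open>The conjugacy result is applied to the conjugating element itself: it lies in
    \<open>T\<close>, hence in \<open>H\<close>.\<close>
  then have "rank1_update n a b \<in> T" using rank1_update_in_T ba ai by blast
  then have h: "rank1_update n a b \<in> H" using T_subset_H by blast
  let ?h = "rank1_update n a b" and ?t = "rank1_update n a c"
  have hc: "?h \<in> carrier (GL n)" using rank1_update_in_GL[OF ba] .
  have tT: "?t \<in> T" using rank1_update_in_T ca cj ai j by blast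
  have tc: "?t \<in> carrier (GL n)" using rank1_update_in_GL[OF ca] .
  \<comment> \<open>The commutator identity without inverses. From g a = e a and b a = 0, the right
    side is g + a (e c + w); as e c + w = e b, both sides equal g + e a b.\<close>
  have "g * ?h = ?h * (g * ?t)"
  proof (rule eq_matI)
    fix k l assume "k < dim_row (?h * (g * ?t))" "l < dim_col (?h * (g * ?t))"
    then have kl: "k < n" "l < n" using gm by simp_all
    have gt: "(g * ?t) $$ (k, l) = g $$ (k, l) + e * a k * c l" if "k < n" for k
      using mult_rank1_update_index[OF gm that kl(2), of a c] ga[OF that] by simp
    have "(\<Sum>k = 0..<n. b k * (g * ?t) $$ (k, l)) =
      (\<Sum>k = 0..<n. b k * g $$ (k, l) + (b k * a k) * (e * c l))"
      by (intro sum.cong) (simp_all add: gt algebra_simps)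
    also have "\<dots> = w l"
      using ba by (simp add: sum.distrib w_def flip: sum_distrib_right)
    finally have "(?h * (g * ?t)) $$ (k, l) = g $$ (k, l) + e * a k * c l + a k * w l"
      using rank1_update_mult_index[OF _ kl, of "g * ?t" a b] gm gt[OF kl(1)] by simp
    also have "\<dots> = g $$ (k, l) + e * a k * b l"
      using e by (simp add: c_def field_simps)
    also have "\<dots> = (g * ?h) $$ (k, l)"
      using mult_rank1_update_index[OF gm kl, of a b] ga[OF kl(1)] by simp
    finally show "(g * ?h) $$ (k, l) = (?h * (g * ?t)) $$ (k, l)" by simp
  qed (use gm in simp_all)
  then have eq: "g \<otimes>\<^bsub>GL n\<^esub> ?h = ?h \<otimes>\<^bsub>GL n\<^esub> (g \<otimes>\<^bsub>GL n\<^esub> ?t)"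
    by (simp add: GL_mult)
  have cancel: "inv\<^bsub>GL n\<^esub> x \<otimes>\<^bsub>GL n\<^esub> (x \<otimes>\<^bsub>GL n\<^esub> y) = y"
    if "x \<in> carrier (GL n)" "y \<in> carrier (GL n)" for x y :: "'a mat"
    using that by (simp flip: GL.m_assoc)
  have "inv\<^bsub>GL n\<^esub> ?h \<otimes>\<^bsub>GL n\<^esub> g \<otimes>\<^bsub>GL n\<^esub> ?h = g \<otimes>\<^bsub>GL n\<^esub> ?t"
    using g hc tc by (simp add: GL.m_assoc eq cancel)
  then have "inv\<^bsub>GL n\<^esub> g \<otimes>\<^bsub>GL n\<^esub> (inv\<^bsub>GL n\<^esub> ?h \<otimes>\<^bsub>GL n\<^esub> g \<otimes>\<^bsub>GL n\<^esub> ?h) = ?t"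
    using g tc by (simp add: cancel)
  with tT have "inv\<^bsub>GL n\<^esub> g \<otimes>\<^bsub>GL n\<^esub> (inv\<^bsub>GL n\<^esub> ?h \<otimes>\<^bsub>GL n\<^esub> g \<otimes>\<^bsub>GL n\<^esub> ?h) \<in> T"
    by simp
  then show ?thesis using h by (rule bexI)
qed

section \<open>Determination of the minimal length\<close>

theorem theorem20:
  fixes n :: nat and H C :: "'a::alg_closed_field mat set"
  assumes "n \<ge> 3"
    and "subgroup H (GL n)"
    and "elementary_group n \<subseteq> H"
    and "noncentral_class (GL n) H C"
  shows "(C = transvection_class n H \<longrightarrow> class_length n H C = 1) \<and>
         (C \<noteq> transvection_class n H \<longrightarrow> class_length n H C = 2)"
proof -
  interpret elementary_overgroup n H
    by (rule elementary_overgroup.intro[OF assms(1-3)])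
  interpret GL: group "GL n" by (rule group_GL)
  obtain g where g: "g \<in> carrier (GL n)" "g \<notin> group_center (GL n)" and C: "C = conj_class (GL n) H g"
    using assms(4) unfolding noncentral_class_def by blast
  have CG: "C \<subseteq> carrier (GL n)"
    unfolding C using conj_class_subset_carrier[OF group_GL subgroup_H g(1)] .
  have inv: "class_inverse (GL n) H C = conj_class (GL n) H (inv\<^bsub>GL n\<^esub> g)"
    unfolding C by (rule class_inverse_conj_class[OF group_GL subgroup_H g(1)])
  have invG: "class_inverse (GL n) H C \<subseteq> carrier (GL n)"
    unfolding inv using conj_class_subset_carrier[OF group_GL subgroup_H] g(1) by simp
  \<comment> \<open>The set of admissible lengths, whose infimum is
    \<open>class_length n H C\<close>.\<close>
  define S where "S = {m. m > 0 \<and> (\<exists>is :: int list. length is = m \<and> set is \<subseteq> {1, -1} \<and>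
      T \<subseteq> set_product (GL n) (map (class_power (GL n) H C) is))}"
  have SI: "length is \<in> S" if "is \<noteq> []" "set is \<subseteq> {1, -1}"
    "T \<subseteq> set_product (GL n) (map (class_power (GL n) H C) is)" for "is"
    unfolding S_def by (rule CollectI, intro conjI exI[of _ "is"]) (use that in simp_all)
  let ?t = "transvection n 0 1 1 :: 'a mat"
  have t: "?t \<in> T" "?t \<in> carrier (GL n)"
    unfolding transvection_class_def
    using conj_class_self[OF group_GL subgroup_H] transvection_01_in_GL by auto
  have class_T: "conj_class (GL n) H x = T" if "x \<in> T" for x
    using conj_class_eq[OF group_GL subgroup_H t(2) that[unfolded transvection_class_def]]
    unfolding transvection_class_def .
  have class_C: "conj_class (GL n) H x = C" if "x \<in> conj_class (GL n) H g" for x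
    unfolding C by (rule conj_class_eq[OF group_GL subgroup_H g(1) that])
  have two: "2 \<in> S"
  proof -
    obtain e a b i j where "i < n" "a i \<noteq> 0"
      "\<And>i. i < n \<Longrightarrow> (\<Sum>k = 0..<n. g $$ (i, k) * a k) = e * a i"
      "(\<Sum>k = 0..<n. b k * a k) = 0" "j < n" "(\<Sum>k = 0..<n. b k * g $$ (k, j)) \<noteq> e * b j"
      using exists_eigenvector_with_covector[OF GL_carrierD[OF g(1)] n3 nonscalar_if_noncentral[OF g]]
      by blast
    from exists_commutator_in_T[OF g(1) this] obtain h where h: "h \<in> H"
      "inv\<^bsub>GL n\<^esub> g \<otimes>\<^bsub>GL n\<^esub> (inv\<^bsub>GL n\<^esub> h \<otimes>\<^bsub>GL n\<^esub> g \<otimes>\<^bsub>GL n\<^esub> h) \<in> T" by blast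
    \<comment> \<open>One commutator in \<open>T\<close> suffices: \<open>T\<close> is the full
      class of that element, and the product of classes contains this full class.\<close>
    have "T = conj_class (GL n) H (inv\<^bsub>GL n\<^esub> g \<otimes>\<^bsub>GL n\<^esub> (inv\<^bsub>GL n\<^esub> h \<otimes>\<^bsub>GL n\<^esub> g \<otimes>\<^bsub>GL n\<^esub> h))"
      by (rule class_T[OF h(2), symmetric])
    also have "\<dots> \<subseteq> class_inverse (GL n) H C <#>\<^bsub>GL n\<^esub> C"
      unfolding inv unfolding C
      by (rule conj_class_commutator_subset[OF group_GL subgroup_H g(1) h(1)])
    also have "\<dots> = set_product (GL n) (map (class_power (GL n) H C) [-1, 1])"
      using set_product_single[OF group_GL CG] by (simp add: set_product_def class_power_def)
    finally have *: "T \<subseteq> set_product (GL n) (map (class_power (GL n) H C) [-1, 1])" .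
    have "length [-1, 1 :: int] \<in> S" by (rule SI[OF _ _ *]) simp_all
    then show ?thesis by (simp add: numeral_2_eq_2)
  qed
  have one: "1 \<in> S \<longleftrightarrow> C = T"
  proof
    assume "C = T"
    then have *: "T \<subseteq> set_product (GL n) (map (class_power (GL n) H C) [1])"
      using set_product_single[OF group_GL CG] by (simp add: class_power_def)
    have "length [1 :: int] \<in> S" by (rule SI[OF _ _ *]) simp_all
    then show "1 \<in> S" by simp
  next
    assume "1 \<in> S"
    then obtain "is" :: "int list" where "is": "length is = 1" "set is \<subseteq> {1, -1}"
      "T \<subseteq> set_product (GL n) (map (class_power (GL n) H C) is)"
      unfolding S_def by blast
    \<comment> \<open>For length one only two inclusions are possible: \<open>T\<close> in
      \<open>C\<close>, or \<open>T\<close> in the inverse class. A common element then identifies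
      the classes, after inverting in the second case.\<close>
    then obtain i where i: "is = [i]" "i \<in> {1, -1}"
      by (auto simp: length_Suc_conv)
    have "T \<subseteq> class_power (GL n) H C i"
      using "is"(3) set_product_single[OF group_GL CG] set_product_single[OF group_GL invG]
      unfolding i(1) by (simp add: class_power_def split: if_splits)
    then have "?t \<in> class_power (GL n) H C i" using t(1) by (rule subsetD)
    then have "?t \<in> C \<or> ?t \<in> conj_class (GL n) H (inv\<^bsub>GL n\<^esub> g)"
      unfolding class_power_def inv by (simp split: if_splits)
    then show "C = T"
    proof
      assume "?t \<in> C"
      then have "?t \<in> conj_class (GL n) H g" unfolding C .
      then show ?thesis
        using class_C class_T[OF t(1)] by metis
    next
      assume "?t \<in> conj_class (GL n) H (inv\<^bsub>GL n\<^esub> g)"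
      then have "inv\<^bsub>GL n\<^esub> ?t \<in> conj_class (GL n) H g"
        using inv_conj_class[OF group_GL subgroup_H, of "inv\<^bsub>GL n\<^esub> g"] g(1)
        by (metis GL.inv_closed GL.inv_inv image_eqI)
      then show ?thesis
        using class_C class_T[OF inv_transvection_01_in_T] by metis
    qed
  qed
  have len: "class_length n H C = Inf S"
    by (simp add: class_length_def S_def)
  \<comment> \<open>Since \<open>S\<close> contains 2, its infimum is attained and is not the
    default value 0 of the empty set.\<close>
  have mem: "class_length n H C \<in> S"
    unfolding len using two by (intro Inf_nat_def1) blast
  have le: "class_length n H C \<le> m" if "m \<in> S" for m
    unfolding len by (rule cInf_lower[OF that]) simp
  have pos: "class_length n H C > 0"
    using mem unfolding S_def by (rule CollectE) (rule conjunct1)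
  show ?thesis
  proof (intro conjI impI)
    assume "C = T"
    then have "class_length n H C \<le> 1" using le one by blast
    then show "class_length n H C = 1" using pos by simp
  next
    assume "C \<noteq> T"
    then have "class_length n H C \<noteq> 1" using mem one by metis
    moreover have "class_length n H C \<noteq> 0" using pos by simp
    moreover have "class_length n H C \<le> 2" using le two by blast
    ultimately show "class_length n H C = 2" by linarith
  qed
qed

end
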